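(* Let $G$ be a finite simple graph on the vertex set $V$ which has a dominating induced matching. The following are equivalent: (a) $G$ is unmixed; (b) there exists an admissible decomposition $V = W \sqcup M$ satisfying condition $(\flat)$; (c) every admissible decomposition $V = W \sqcup M$ satisfies condition $(\flat)$. Here, for an admissible decomposition $V = W \sqcup M$ with $G_M$ consisting of the $m$ disjoint edges $\{x_{j1}, x_{j2}\}$, $j = 1, \ldots, m$, condition $(\flat)$ is: for every subset $M_2 \subseteq M$ (the empty set included) such that $(\ast 1)$ $\#(M_2 \cap \{x_{j1}, x_{j2}\}) \le 1$ for all $j = 1, \ldots, m$, and $(\ast 2)$ $\deg_G x \ge 2$ for all $x \in M_2$, the following two conditions hold: \[ (\flat 1)\quad m_2 - m_2' = \# N_G(M_2) - \# M_2, \qquad (\flat 2)\quad \# W_0 \le 2 m_2 - \# N_G(M_2) + \# M_2 + \# IN_G(M_2, W). \]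
   Context: All graphs are finite and simple. A matching is a set of pairwise disjoint edges; it is maximal if no further edge can be added. Two edges $e,e'$ are $3$-disjoint if $e\cap e'=\emptyset$ and no edge meets both; an induced matching is a set of pairwise $3$-disjoint edges. A dominating induced matching is an induced matching which is also a maximal matching. For $W \subseteq V$, $G_W$ denotes the induced subgraph on $W$ and $G \setminus W$ denotes $G_{V \setminus W}$. $N_G(x)$ is the set of neighbours of $x$, $N_G[x] = N_G(x) \cup \{x\}$, $\deg_G x = \# N_G(x)$, and for $U \subseteq V$, $N_G(U) = \bigcup_{x \in U} N_G(x)$, $N_G[U] = \bigcup_{x \in U} N_G[x]$. A set of vertices is independent if no two of its vertices are adjacent. A vertex cover is a set of vertices meeting every edge; $G$ is unmixed if all minimal vertex covers of $G$ have the same cardinality. An admissible decomposition is a partition $V = W \sqcup M$ such that $W$ is an independent set of $G$ and the induced subgraph $G_M$ is a disjoint union of $m$ edges $\{x_{j1}, x_{j2}\}$, $j = 1, \ldots, m$ (such a decomposition exists precisely when $G$ has a dominating induced matching). Given such a decomposition: $W_0$ is the set of vertices of $W$ that are not isolated in $G$; $m_2$ is the number of indices $j$ with $\deg_G x_{j1} \ge 2$ and $\deg_G x_{j2} \ge 2$; for $U \subseteq V$, $IN_G(U, W)$ is the set of isolated vertices of $G \setminus N_G[U]$ that belong to $W_0$. For $M_2 \subseteq M$, let $G' = G \setminus N_G[M_2]$, and let $m_2'$ be the number of indices $j$ such that both $x_{j1}, x_{j2}$ are vertices of $G'$ and $\deg_{G'} x_{j1} \ge 2$ and $\deg_{G'}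 x_{j2} \ge 2$ (in particular $m_2' = 0$ if $G'$ has no edges). *)

theory Defs
  imports Main "HOL-Library.Disjoint_Sets"
begin

record 'a sgraph =
  verts :: "'a set"
  edges :: "'a set set"

definition finite_simple_graph :: "'a sgraph \<Rightarrow> bool" where
  "finite_simple_graph G \<longleftrightarrow>
     finite (verts G) \<and> (\<forall>e\<in>edges G. e \<subseteq> verts G \<and> card e = 2)"

definition induced :: "'a sgraph \<Rightarrow> 'a set \<Rightarrow> 'a sgraph" where
  "induced G U = \<lparr>verts = verts G \<inter> U, edges = {e \<in> edges G. e \<subseteq> U}\<rparr>"

definition del_verts :: "'a sgraph \<Rightarrow> 'a set \<Rightarrow> 'a sgraph" where
  "del_verts G U = induced G (verts G - U)"

definition nbrs :: "'a sgraph \<Rightarrow> 'a \<Rightarrow> 'a set" where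
  "nbrs G x = {y. {x, y} \<in> edges G}"

definition closed_nbrs :: "'a sgraph \<Rightarrow> 'a \<Rightarrow> 'a set" where
  "closed_nbrs G x = nbrs G x \<union> {x}"

definition deg :: "'a sgraph \<Rightarrow> 'a \<Rightarrow> nat" where
  "deg G x = card (nbrs G x)"

definition set_nbrs :: "'a sgraph \<Rightarrow> 'a set \<Rightarrow> 'a set" where
  "set_nbrs G U = (\<Union>x\<in>U. nbrs G x)"

definition closed_set_nbrs :: "'a sgraph \<Rightarrow> 'a set \<Rightarrow> 'a set" where
  "closed_set_nbrs G U = (\<Union>x\<in>U. closed_nbrs G x)"

definition isolated :: "'a sgraph \<Rightarrow> 'a set" where
  "isolated G = {x \<in> verts G. nbrs G x = {}}"

definition independent :: "'a sgraph \<Rightarrow> 'a set \<Rightarrow> bool" where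
  "independent G U \<longleftrightarrow> U \<subseteq> verts G \<and> (\<forall>x\<in>U. \<forall>y\<in>U. {x, y} \<notin> edges G)"

definition vertex_cover :: "'a sgraph \<Rightarrow> 'a set \<Rightarrow> bool" where
  "vertex_cover G C \<longleftrightarrow> C \<subseteq> verts G \<and> (\<forall>e\<in>edges G. e \<inter> C \<noteq> {})"

definition minimal_vertex_cover :: "'a sgraph \<Rightarrow> 'a set \<Rightarrow> bool" where
  "minimal_vertex_cover G C \<longleftrightarrow> vertex_cover G C \<and> (\<forall>D. D \<subset> C \<longrightarrow> \<not> vertex_cover G D)"

definition unmixed :: "'a sgraph \<Rightarrow> bool" where
  "unmixed G \<longleftrightarrow>
     (\<forall>C D. minimal_vertex_cover G C \<longrightarrow> minimal_vertex_cover G D \<longrightarrow> card C = card D)"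

definition matching :: "'a sgraph \<Rightarrow> 'a set set \<Rightarrow> bool" where
  "matching G S \<longleftrightarrow> S \<subseteq> edges G \<and> disjoint S"

definition maximal_matching :: "'a sgraph \<Rightarrow> 'a set set \<Rightarrow> bool" where
  "maximal_matching G S \<longleftrightarrow>
     matching G S \<and> (\<forall>e\<in>edges G - S. \<not> matching G (insert e S))"

definition three_disjoint :: "'a sgraph \<Rightarrow> 'a set \<Rightarrow> 'a set \<Rightarrow> bool" where
  "three_disjoint G e e' \<longleftrightarrow>
     e \<inter> e' = {} \<and> \<not> (\<exists>f\<in>edges G. f \<inter> e \<noteq> {} \<and> f \<inter> e' \<noteq> {})"

definition induced_matching :: "'a sgraph \<Rightarrow> 'a set set \<Rightarrow> bool" where
  "induced_matching G S \<longleftrightarrow> S \<subseteq> edges G \<and> pairwise (three_disjoint G) S"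

definition dominating_induced_matching :: "'a sgraph \<Rightarrow> 'a set set \<Rightarrow> bool" where
  "dominating_induced_matching G S \<longleftrightarrow> induced_matching G S \<and> maximal_matching G S"

text \<open>
  The last two conjuncts say that the subgraph induced on \<open>M\<close> is a disjoint union of edges.
  These edges \<open>{x\<^sub>j\<^sub>1, x\<^sub>j\<^sub>2}\<close> are the elements of \<open>edges (induced G M)\<close>, so counting
  indices \<open>j\<close> below means counting elements of that set.
\<close>
definition admissible_decomposition :: "'a sgraph \<Rightarrow> 'a set \<Rightarrow> 'a set \<Rightarrow> bool" where
  "admissible_decomposition G W M \<longleftrightarrow>
     verts G = W \<union> M \<and> W \<inter> M = {} \<and> independent G W \<and>
     disjoint (edges (induced G M)) \<and> \<Union> (edges (induced G M)) = M"

definition W0 :: "'a sgraph \<Rightarrow> 'a set \<Rightarrow> 'a set" where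
  "W0 G W = W - isolated G"

text \<open>
  The subgraph \<open>H\<close> of \<open>G\<close> is \<open>G\<close> itself for \<open>m\<^sub>2\<close>,
  and \<open>G'\<close> for \<open>m\<^sub>2'\<close>; the edges are always those of \<open>G\<^sub>M\<close>.
\<close>
definition m2_in :: "'a sgraph \<Rightarrow> 'a set \<Rightarrow> 'a sgraph \<Rightarrow> nat" where
  "m2_in G M H =
     card {e \<in> edges (induced G M). e \<subseteq> verts H \<and> (\<forall>x\<in>e. deg H x \<ge> 2)}"

definition IN :: "'a sgraph \<Rightarrow> 'a set \<Rightarrow> 'a set \<Rightarrow> 'a set" where
  "IN G U W = isolated (del_verts G (closed_set_nbrs G U)) \<inter> W0 G W"

definition flat1 :: "'a sgraph \<Rightarrow> 'a set \<Rightarrow> 'a set \<Rightarrow> bool" where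
  "flat1 G M M\<^sub>2 \<longleftrightarrow>
     int (m2_in G M G) - int (m2_in G M (del_verts G (closed_set_nbrs G M\<^sub>2)))
       = int (card (set_nbrs G M\<^sub>2)) - int (card M\<^sub>2)"

definition flat2 :: "'a sgraph \<Rightarrow> 'a set \<Rightarrow> 'a set \<Rightarrow> 'a set \<Rightarrow> bool" where
  "flat2 G W M M\<^sub>2 \<longleftrightarrow>
     int (card (W0 G W)) \<le> 2 * int (m2_in G M G) - int (card (set_nbrs G M\<^sub>2))
       + int (card M\<^sub>2) + int (card (IN G M\<^sub>2 W))"

definition flat :: "'a sgraph \<Rightarrow> 'a set \<Rightarrow> 'a set \<Rightarrow> bool" where
  "flat G W M \<longleftrightarrow>
     (\<forall>M\<^sub>2 \<subseteq> M. (\<forall>e\<in>edges (induced G M). card (M\<^sub>2 \<inter> e) \<le> 1) \<longrightarrow>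
        (\<forall>x\<in>M\<^sub>2. deg G x \<ge> 2) \<longrightarrow>
        flat1 G M M\<^sub>2 \<and> flat2 G W M M\<^sub>2)"

end

theory Submission
  imports Defs
begin

text \<open>
  Minimal vertex covers are the complements of maximal independent sets. For an admissible
  decomposition \<open>W \<squnion> M\<close> with \<open>m\<close> matching edges and a partial transversal \<open>N \<subseteq> M\<close> of these
  edges, add to \<open>N\<close> an endpoint of degree one in \<open>G' = G \<setminus> N[N]\<close> from every edge of \<open>G'\<close> not counted by
  \<open>m\<^sub>2'\<close>; together with \<open>W \<setminus> N(N)\<close> this is a maximal independent set of size
  \<open>m - m\<^sub>2' + #W - #(N(N) \<inter> W)\<close>, and every maximal independent set has this size for its own trace
  \<open>N\<close> on \<open>M\<close>. Since \<open>#N(N) - #N = #(N(N) \<inter> W)\<close>, unmixedness amounts to (flat 1) for all \<open>N\<close>.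
  Condition (flat 2) then follows from a local form of Berge's theorem that a well-covered graph without
  isolated vertices satisfies \<open>#A \<le> #N(A)\<close> for every independent set \<open>A\<close>.
\<close>

section \<open>Maximal independent sets\<close>

definition maximal_independent :: "'a sgraph \<Rightarrow> 'a set \<Rightarrow> bool" where
  "maximal_independent G S \<longleftrightarrow>
     independent G S \<and> (\<forall>x\<in>verts G - S. nbrs G x \<inter> S \<noteq> {})"

locale simple_graph =
  fixes G :: "'a sgraph"
  assumes finite_simple_graph: "finite_simple_graph G"
begin

lemma finite_verts [simp]: "finite (verts G)"
  using finite_simple_graph by (simp add: finite_simple_graph_def)

lemma edge_subset: "e \<in> edges G \<Longrightarrow> e \<subseteq> verts G"
  using finite_simple_graph by (simp add: finite_simple_graph_def)

lemma card_edge: "e \<in> edges G \<Longrightarrow> card e = 2"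
  using finite_simple_graph by (simp add: finite_simple_graph_def)

lemma edge_obtain:
  assumes "e \<in> edges G"
  obtains x y where "e = {x, y}" "x \<noteq> y" "y \<in> nbrs G x"
  using card_edge[OF assms] assms by (auto simp: card_2_iff nbrs_def)

lemma nbrs_subset: "nbrs G x \<subseteq> verts G"
  using edge_subset by (auto simp: nbrs_def)

lemma nbrs_sym: "y \<in> nbrs G x \<longleftrightarrow> x \<in> nbrs G y"
  by (simp add: nbrs_def insert_commute)

lemma nbrs_irrefl [simp]: "x \<notin> nbrs G x"
  using card_edge[of "{x, x}"] by (auto simp: nbrs_def)

lemma finite_nbrs [simp]: "finite (nbrs G x)"
  using nbrs_subset finite_verts finite_subset by blast

lemma set_nbrs_subset: "set_nbrs G U \<subseteq> verts G"
  using nbrs_subset by (auto simp: set_nbrs_def)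

lemma finite_set_nbrs [simp]: "finite (set_nbrs G U)"
  using set_nbrs_subset finite_verts finite_subset by blast

lemma independent_iff: "independent G S \<longleftrightarrow> S \<subseteq> verts G \<and> S \<inter> set_nbrs G S = {}"
  by (auto simp: independent_def set_nbrs_def nbrs_def)

lemma vertex_cover_iff: "vertex_cover G C \<longleftrightarrow> C \<subseteq> verts G \<and> independent G (verts G - C)"
proof -
  have "(\<forall>e\<in>edges G. e \<inter> C \<noteq> {}) \<longleftrightarrow> (\<forall>x\<in>verts G - C. \<forall>y\<in>verts G - C. {x, y} \<notin> edges G)"
  proof safe
    fix e assume indep: "\<forall>x\<in>verts G - C. \<forall>y\<in>verts G - C. {x, y} \<notin> edges G"
      and e: "e \<in> edges G" "e \<inter> C = {}"
    obtain x y where "e = {x, y}" using edge_obtain[OF e(1)] by metis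
    then show False using indep e edge_subset[OF e(1)] by auto
  qed auto
  then show ?thesis by (auto simp: vertex_cover_def independent_def)
qed

text \<open>Removing \<open>x\<close> from a cover \<open>C\<close> can only uncover edges at
  \<open>x\<close>, and it uncovers one exactly when \<open>x\<close> has a neighbour outside
  \<open>C\<close>. Minimality of \<open>C\<close> is therefore domination of every vertex of
  \<open>C\<close> by the complement, which is maximality of that independent complement.\<close>

lemma minimal_vertex_cover_iff:
  "minimal_vertex_cover G C \<longleftrightarrow> C \<subseteq> verts G \<and> maximal_independent G (verts G - C)"
proof
  assume C: "minimal_vertex_cover G C"
  then have cov: "C \<subseteq> verts G" "independent G (verts G - C)"
    by (auto simp: minimal_vertex_cover_def vertex_cover_iff)
  have "nbrs G x \<inter> (verts G - C) \<noteq> {}" if x: "x \<in> C" for x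
  proof
    assume no: "nbrs G x \<inter> (verts G - C) = {}"
    have "vertex_cover G (C - {x})"
      unfolding vertex_cover_def
    proof (intro conjI ballI)
      show "C - {x} \<subseteq> verts G" using cov by auto
      fix e assume e: "e \<in> edges G"
      show "e \<inter> (C - {x}) \<noteq> {}"
      proof (cases "x \<in> e")
        case True
        then obtain y where "e = {x, y}" "y \<noteq> x" "y \<in> nbrs G x"
          using edge_obtain[OF e] nbrs_sym by (metis insertE insert_commute singletonD)
        then show ?thesis using no nbrs_subset by auto
      next
        case False
        then show ?thesis using C e by (auto simp: minimal_vertex_cover_def vertex_cover_def)
      qed
    qed
    then show False using C x by (auto simp: minimal_vertex_cover_def)
  qed
  then show "C \<subseteq> verts G \<and> maximal_independent G (verts G - C)"
    using cov by (auto simp: maximal_independent_def)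
next
  assume C: "C \<subseteq> verts G \<and> maximal_independent G (verts G - C)"
  have "\<not> vertex_cover G D" if D: "D \<subset> C" for D
  proof
    assume "vertex_cover G D"
    then have "independent G (verts G - D)" by (simp add: vertex_cover_iff)
    moreover obtain x where "x \<in> C - D" using D by auto
    ultimately have "nbrs G x \<inter> (verts G - D) = {}"
      using C by (auto simp: independent_def nbrs_def)
    then show False using C D \<open>x \<in> C - D\<close> unfolding maximal_independent_def by blast
  qed
  then show "minimal_vertex_cover G C"
    using C by (auto simp: minimal_vertex_cover_def vertex_cover_iff maximal_independent_def)
qed

lemma maximal_independent_subset: "maximal_independent G S \<Longrightarrow> S \<subseteq> verts G"
  by (simp add: maximal_independent_def independent_def)

lemma unmixed_iff:
  "unmixed G \<longleftrightarrow>
     (\<forall>S T. maximal_independent G S \<longrightarrow> maximal_independent G T \<longrightarrow> card S = card T)"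
proof
  assume um: "unmixed G"
  show "\<forall>S T. maximal_independent G S \<longrightarrow> maximal_independent G T \<longrightarrow> card S = card T"
  proof (intro allI impI)
    fix S T assume S: "maximal_independent G S" and T: "maximal_independent G T"
    have "minimal_vertex_cover G (verts G - S)" "minimal_vertex_cover G (verts G - T)"
      using S T maximal_independent_subset
      by (auto simp: minimal_vertex_cover_iff double_diff)
    then have "card (verts G - S) = card (verts G - T)" using um unfolding unmixed_def by blast
    moreover have "card (verts G - U) = card (verts G) - card U" "card U \<le> card (verts G)"
      if "maximal_independent G U" for U
      using maximal_independent_subset[OF that] card_Diff_subset[of U "verts G"]
        card_mono[of "verts G" U] finite_subset[of U "verts G"] by auto
    ultimately show "card S = card T"
      using S T by (metis diff_diff_cancel)
  qed
next
  assume eq: "\<forall>S T. maximal_independent G S \<longrightarrow> maximal_independent G T \<longrightarrow> card S = card T"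
  show "unmixed G"
    unfolding unmixed_def
  proof (intro allI impI)
    fix C D assume "minimal_vertex_cover G C" "minimal_vertex_cover G D"
    then have C: "C \<subseteq> verts G" "maximal_independent G (verts G - C)"
      and D: "D \<subseteq> verts G" "maximal_independent G (verts G - D)"
      by (simp_all add: minimal_vertex_cover_iff)
    have "card (verts G - C) = card (verts G - D)" by (rule eq[rule_format, OF C(2) D(2)])
    with C(1) D(1) show "card C = card D"
      by (metis finite_verts card_Diff_subset card_mono diff_diff_cancel finite_subset)
  qed
qed

section \<open>Extension of independent sets and Berge's inequality\<close>

lemma independent_extend:
  assumes "independent G I"
  obtains S where "I \<subseteq> S" "maximal_independent G S"
proof -
  let ?F = "{S. I \<subseteq> S \<and> independent G S}"
  have "finite ?F"
    by (rule finite_subset[of _ "Pow (verts G)"]) (auto simp: independent_def)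
  moreover have "I \<in> ?F" using assms by simp
  ultimately obtain S where S: "S \<in> ?F" and "\<forall>T\<in>?F. S \<subseteq> T \<longrightarrow> S = T"
    using finite_has_maximal[of ?F] by auto
  then have max: "S = T" if "T \<in> ?F" "S \<subseteq> T" for T
    using that by blast
  have "nbrs G x \<inter> S \<noteq> {}" if x: "x \<in> verts G - S" for x
  proof
    assume "nbrs G x \<inter> S = {}"
    then have "y \<notin> nbrs G x \<and> x \<notin> nbrs G y" if "y \<in> insert x S" for y
      using that nbrs_sym[of y x] nbrs_irrefl[of x] by blast
    then have "independent G (insert x S)"
      using S x by (auto simp: independent_def nbrs_def)
    then have "S = insert x S" using S by (intro max) auto
    then show False using x by blast
  qed
  then show thesis using S that[of S] unfolding maximal_independent_def by blast
qed

lemma unmixed_card_independent_le: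
  assumes "unmixed G" "maximal_independent G S" "independent G I"
  shows "card I \<le> card S"
proof -
  obtain T where T: "I \<subseteq> T" "maximal_independent G T"
    using independent_extend[OF assms(3)] .
  then have "card I \<le> card T"
    using maximal_independent_subset by (metis card_mono finite_subset finite_verts)
  then show ?thesis using T assms unmixed_iff by metis
qed

text \<open>
  Berge's inequality, applied inside the subgraph \<open>G \<setminus> N[X]\<close>.
\<close>
lemma unmixed_card_le_card_nbrs:
  assumes um: "unmixed G" and X: "independent G X"
    and A: "independent G A" "A \<inter> set_nbrs G X = {}"
    and nonisolated: "\<And>a. a \<in> A \<Longrightarrow> \<exists>u\<in>nbrs G a. u \<notin> set_nbrs G X"
  shows "card A \<le> card (set_nbrs G A - set_nbrs G X)"
proof -
  have "finite A" using A(1) by (meson finite_subset finite_verts independent_def)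
  then show ?thesis using A nonisolated
  proof (induction A rule: finite_psubset_induct)
    case (psubset A)
    show ?case
    proof (cases "A = {}")
      case False
      then obtain a u where a: "a \<in> A" and u: "u \<in> nbrs G a" "u \<notin> set_nbrs G X"
        using psubset.prems(3) by blast
      \<comment> \<open>Forcing \<open>u\<close> into \<open>S\<close> keeps its neighbour
        \<open>a\<close> out, so \<open>A \<inter> S\<close> is a proper subset of \<open>A\<close>
        and falls under the induction hypothesis. The rest \<open>A - S\<close> is handled by an
        exchange argument.\<close>
      have "independent G (insert u X)"
        using X u nbrs_subset nbrs_irrefl[of u]
        by (auto simp: independent_def set_nbrs_def nbrs_def insert_commute)
      then obtain S where S: "insert u X \<subseteq> S" "maximal_independent G S"
        using independent_extend by blast
      have Sind: "independent G S" using S by (simp add: maximal_independent_def)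
      have "finite S" using maximal_independent_subset[OF S(2)] finite_subset finite_verts by blast
      have "a \<notin> S" using Sind S(1) u by (auto simp: independent_def nbrs_def)
      then have "A \<inter> S \<subset> A" using a by auto
      then have IH: "card (A \<inter> S) \<le> card (set_nbrs G (A \<inter> S) - set_nbrs G X)"
        using psubset.prems by (intro psubset.IH) (auto simp: independent_def)
      let ?B = "A - S"
      let ?N = "set_nbrs G ?B \<inter> S"
      text \<open>Exchanging \<open>?N\<close> for \<open>?B\<close> in the maximum independent set \<open>S\<close> cannot enlarge it.\<close>
      have "independent G ((S - ?N) \<union> ?B)"
        using Sind psubset.prems(1)
        by (auto simp: independent_def set_nbrs_def nbrs_def insert_commute)
      then have "card ((S - ?N) \<union> ?B) \<le> card S"
        by (rule unmixed_card_independent_le[OF um S(2)])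
      moreover have "card ((S - ?N) \<union> ?B) = card (S - ?N) + card ?B"
        using \<open>finite S\<close> psubset.hyps by (intro card_Un_disjoint) auto
      moreover have "card (S - ?N) + card ?N = card S"
        using card_Int_Diff[OF \<open>finite S\<close>, of ?N] by (simp add: Int_left_commute Int_commute)
      ultimately have B: "card ?B \<le> card ?N" by simp
      \<comment> \<open>The two bounds add up because they count disjoint sets: neighbours of
        \<open>A \<inter> S\<close> lie outside the independent set \<open>S\<close>, whereas
        \<open>?N\<close> lies inside it. As \<open>X \<subseteq> S\<close>, independence of
        \<open>S\<close> also keeps \<open>?N\<close> away from N(X).\<close>
      have disj: "set_nbrs G (A \<inter> S) \<inter> S = {}"
        using Sind by (auto simp: independent_iff set_nbrs_def)
      have sub: "?N \<subseteq> set_nbrs G A - set_nbrs G X"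
        using Sind S(1) by (auto simp: independent_iff set_nbrs_def)
      have "card A = card (A \<inter> S) + card ?B"
        using psubset.hyps by (simp add: card_Int_Diff)
      also have "\<dots> \<le> card (set_nbrs G (A \<inter> S) - set_nbrs G X) + card ?N"
        using IH B by simp
      also have "\<dots> = card ((set_nbrs G (A \<inter> S) - set_nbrs G X) \<union> ?N)"
        using disj by (intro card_Un_disjoint[symmetric]) auto
      also have "\<dots> \<le> card (set_nbrs G A - set_nbrs G X)"
        using sub by (intro card_mono finite_Diff finite_set_nbrs) (auto simp: set_nbrs_def)
      finally show ?thesis .
    qed simp
  qed
qed

section \<open>Deletion of vertices\<close>

lemma closed_set_nbrs_eq: "closed_set_nbrs G U = set_nbrs G U \<union> U"
  by (auto simp: closed_set_nbrs_def closed_nbrs_def set_nbrs_def)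

lemma verts_del_verts: "verts (del_verts G U) = verts G - U"
  by (auto simp: del_verts_def induced_def)

lemma nbrs_del_verts: "x \<in> verts G - U \<Longrightarrow> nbrs (del_verts G U) x = nbrs G x - U"
  using nbrs_subset by (auto simp: del_verts_def induced_def nbrs_def)

lemma del_verts_empty: "del_verts G {} = G"
proof -
  have "{e \<in> edges G. e \<subseteq> verts G} = edges G" using edge_subset by auto
  then show ?thesis by (simp add: del_verts_def induced_def)
qed

end

section \<open>Admissible decompositions\<close>

locale decomposed_graph = simple_graph +
  fixes W M :: "'a set"
  assumes decomposition: "admissible_decomposition G W M"
begin

abbreviation E :: "'a set set" where "E \<equiv> edges (induced G M)"

text \<open>Meaningful for \<open>x \<in> M\<close> only, where the intersection is a singleton by
  \<open>nbrs_M\<close>; there \<open>mate\<close> is an involution exchanging the endpoints of each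
  matching edge.\<close>

definition mate :: "'a \<Rightarrow> 'a" where "mate x = the_elem (nbrs G x \<inter> M)"

lemma verts_eq: "verts G = W \<union> M" and W_M_disjoint: "W \<inter> M = {}" 
  and independent_W: "independent G W" and disjoint_E: "disjoint E" and Union_E: "\<Union> E = M"
  using decomposition by (auto simp: admissible_decomposition_def)

lemma finite_W [simp]: "finite W" and finite_M [simp]: "finite M"
  using finite_verts by (simp_all add: verts_eq)

lemma finite_E [simp]: "finite E"
  using Union_E finite_M finite_UnionD by metis

lemma E_iff: "e \<in> E \<longleftrightarrow> e \<in> edges G \<and> e \<subseteq> M"
  by (simp add: induced_def)

lemma E_eqI: "e \<in> E \<Longrightarrow> f \<in> E \<Longrightarrow> x \<in> e \<Longrightarrow> x \<in> f \<Longrightarrow> e = f"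
  using disjoint_E by (auto simp only: disjoint_def)

text \<open>Every neighbour of \<open>x\<close> in \<open>M\<close> spans with \<open>x\<close> an
  edge of \<open>E\<close>, and the disjoint family \<open>E\<close> has only one member through
  \<open>x\<close>.\<close>

lemma nbrs_M: assumes "x \<in> M" shows "nbrs G x \<inter> M = {mate x}"
proof -
  obtain e where e: "e \<in> E" "x \<in> e" using assms Union_E by blast
  obtain y where y: "e = {x, y}" 
    using edge_obtain e E_iff by (metis insertE insert_commute singletonD)
  have "nbrs G x \<inter> M = {y}"
  proof (intro equalityI subsetI)
    fix z assume z: "z \<in> nbrs G x \<inter> M"
    then have "{x, z} \<in> E" using assms by (auto simp: E_iff nbrs_def)
    then have "{x, z} = e" using e by (intro E_eqI[of _ _ x]) auto
    then show "z \<in> {y}" using y z by (auto simp: doubleton_eq_iff)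
  next
    fix z assume "z \<in> {y}"
    then show "z \<in> nbrs G x \<inter> M" using e y by (auto simp: E_iff nbrs_def)
  qed
  then show ?thesis by (simp add: mate_def)
qed

lemma mate_in_M: "x \<in> M \<Longrightarrow> mate x \<in> M" and mate_nbr: "x \<in> M \<Longrightarrow> mate x \<in> nbrs G x"
  using nbrs_M by auto

lemma mate_mate: "x \<in> M \<Longrightarrow> mate (mate x) = x"
  using nbrs_M[of "mate x"] mate_in_M[of x] mate_nbr[of x] nbrs_sym[of x "mate x"]
  by (metis IntI singletonD)

lemma mate_neq: "x \<in> M \<Longrightarrow> mate x \<noteq> x"
  using mate_nbr nbrs_irrefl by metis

lemma mate_edge: "x \<in> M \<Longrightarrow> {x, mate x} \<in> E"
  using mate_nbr mate_in_M by (simp add: E_iff nbrs_def)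

lemma E_mate: "e \<in> E \<Longrightarrow> x \<in> e \<Longrightarrow> e = {x, mate x}"
  using mate_edge[of x] Union_E by (intro E_eqI[of _ _ x]) auto

lemma E_obtain:
  assumes "e \<in> E"
  obtains x where "x \<in> M" "e = {x, mate x}"
proof -
  have "e \<noteq> {}" using card_edge assms E_iff by fastforce
  then show thesis using that E_mate assms E_iff by (metis all_not_in_conv subsetD)
qed

lemma inj_on_mate: "inj_on mate M"
  by (metis inj_onI mate_mate)

lemma card_M: "card M = 2 * card E"
proof -
  have "card (\<Union> E) = (\<Sum>e\<in>E. card e)"
    using disjoint_E card_edge E_iff finite_M
    by (intro card_Union_disjoint) (auto simp: disjoint_def pairwise_def disjnt_def dest: finite_subset)
  also have "\<dots> = (\<Sum>e\<in>E. 2)" using card_edge E_iff by (intro sum.cong) auto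
  finally show ?thesis using Union_E by simp
qed

lemma nbrs_W:
  assumes "x \<in> W"
  shows "nbrs G x \<subseteq> M"
proof -
  have "nbrs G x \<inter> W = {}" using assms independent_W by (auto simp: independent_def nbrs_def)
  then show ?thesis using nbrs_subset[of x] verts_eq by blast
qed

section \<open>Partial transversals of the matching edges\<close>

definition partial_transversal :: "'a set \<Rightarrow> bool" where
  "partial_transversal N \<longleftrightarrow> N \<subseteq> M \<and> (\<forall>x\<in>N. mate x \<notin> N)"

lemma partial_transversal_iff:
  "partial_transversal N \<longleftrightarrow> N \<subseteq> M \<and> (\<forall>e\<in>E. card (N \<inter> e) \<le> 1)"
proof (cases "N \<subseteq> M")
  case True
  have "(\<forall>x\<in>N. mate x \<notin> N) \<longleftrightarrow> (\<forall>e\<in>E. card (N \<inter> e) \<le> 1)"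
  proof
    assume N: "\<forall>x\<in>N. mate x \<notin> N"
    show "\<forall>e\<in>E. card (N \<inter> e) \<le> 1"
    proof
      fix e assume "e \<in> E"
      then obtain x where "x \<in> M" "e = {x, mate x}" using E_obtain by blast
      then have "N \<inter> e \<subseteq> {x} \<or> N \<inter> e \<subseteq> {mate x}" using N by auto
      then show "card (N \<inter> e) \<le> 1"
        by (metis card.empty card_insert_disjoint empty_iff finite.intros One_nat_def card_mono)
    qed
  next
    assume N: "\<forall>e\<in>E. card (N \<inter> e) \<le> 1"
    show "\<forall>x\<in>N. mate x \<notin> N"
    proof (intro ballI notI)
      fix x assume x: "x \<in> N" "mate x \<in> N"
      then have "N \<inter> {x, mate x} = {x, mate x}" by auto
      moreover have "card {x, mate x} = 2" using x True mate_neq[of x] by auto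
      ultimately show False using N mate_edge[of x] x True by fastforce
    qed
  qed
  then show ?thesis using True by (simp add: partial_transversal_def)
qed (simp add: partial_transversal_def)

lemma set_nbrs_M: "N \<subseteq> M \<Longrightarrow> set_nbrs G N \<inter> M = mate ` N"
  using nbrs_M by (auto simp: set_nbrs_def)

lemma partial_transversal_disjoint:
  assumes "partial_transversal N"
  shows "N \<inter> set_nbrs G N = {}"
proof -
  have N: "N \<subseteq> M" "\<And>x. x \<in> N \<Longrightarrow> mate x \<notin> N"
    using assms by (auto simp: partial_transversal_def)
  then have "N \<inter> mate ` N = {}" by blast
  then show ?thesis using set_nbrs_M[OF N(1)] N(1) by blast
qed

lemma independent_Un:
  assumes "partial_transversal N" "U \<subseteq> W" "U \<inter> set_nbrs G N = {}"
  shows "independent G (N \<union> U)"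
proof -
  have "{x, y} \<notin> edges G" if "x \<in> N \<union> U" "y \<in> N \<union> U" for x y
  proof (cases "x \<in> N")
    case True
    then have "y \<notin> nbrs G x"
      using that(2) assms(3) partial_transversal_disjoint[OF assms(1)] by (auto simp: set_nbrs_def)
    then show ?thesis by (simp add: nbrs_def)
  next
    case False
    then have x: "x \<in> U" using that by simp
    show ?thesis
    proof (cases "y \<in> N")
      case True
      then have "x \<notin> nbrs G y" using x assms(3) by (auto simp: set_nbrs_def)
      then show ?thesis by (simp add: nbrs_def insert_commute)
    next
      case False
      then show ?thesis using that x assms(2) independent_W by (auto simp: independent_def)
    qed
  qed
  then show ?thesis
    using assms(1,2) verts_eq by (auto simp: independent_def partial_transversal_def)
qed

text \<open>The neighbours of \<open>N\<close> in \<open>M\<close> are the mates, as many as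
  \<open>N\<close> has elements because \<open>mate\<close> is injective. Hence the quantity #N(N) -
  #N in both parts of (flat) just counts the neighbours of \<open>N\<close> in
  \<open>W\<close>.\<close>

lemma card_set_nbrs:
  assumes "N \<subseteq> M"
  shows "card (set_nbrs G N) = card N + card (set_nbrs G N \<inter> W)"
proof -
  have "set_nbrs G N = mate ` N \<union> (set_nbrs G N \<inter> W)"
    using set_nbrs_M[OF assms] set_nbrs_subset verts_eq by blast
  moreover have "mate ` N \<inter> (set_nbrs G N \<inter> W) = {}"
    using assms mate_in_M W_M_disjoint by blast
  moreover have "card (mate ` N) = card N"
    using assms inj_on_mate by (meson card_image inj_on_subset)
  ultimately show ?thesis
    by (metis card_Un_disjoint finite_Un finite_set_nbrs)
qed

section \<open>Matching edges that survive the deletion of N[N]\<close>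

definition untouched :: "'a set \<Rightarrow> 'a set set" where
  "untouched N = {e \<in> E. e \<inter> N = {}}"

text \<open>For \<open>N \<subseteq> M\<close> these are the edges counted by
  \<open>m\<^sub>2'\<close>: the untouched edges are those lying in G', and an endpoint has degree
  at least 2 in G' iff it keeps a neighbour in \<open>W\<close> besides its mate.\<close>

definition full_edges :: "'a set \<Rightarrow> 'a set set" where
  "full_edges N = {e \<in> untouched N. \<forall>x\<in>e. nbrs G x \<inter> W - set_nbrs G N \<noteq> {}}"

lemma full_edges_subset: "full_edges N \<subseteq> untouched N"
  by (auto simp: full_edges_def)

lemma finite_untouched [simp]: "finite (untouched N)"
  by (simp add: untouched_def)

lemma finite_full_edges [simp]: "finite (full_edges N)"
  using full_edges_subset finite_subset finite_untouched by blast

text \<open>A partial transversal meets every matching edge at most once, so sending a vertex to its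
  edge is a bijection from \<open>N\<close> onto the touched edges.\<close>

lemma card_untouched:
  assumes "partial_transversal N"
  shows "card (untouched N) + card N = card E"
proof -
  have "N \<subseteq> M" using assms by (simp add: partial_transversal_def)
  have "bij_betw (\<lambda>x. {x, mate x}) N (E - untouched N)"
    unfolding bij_betw_def
  proof
    show "inj_on (\<lambda>x. {x, mate x}) N"
      using assms by (auto simp: inj_on_def doubleton_eq_iff partial_transversal_def)
    show "(\<lambda>x. {x, mate x}) ` N = E - untouched N"
      using E_mate mate_edge \<open>N \<subseteq> M\<close> by (fastforce simp: untouched_def)
  qed
  then have "card N = card (E - untouched N)" by (rule bij_betw_same_card)
  also have "\<dots> = card E - card (untouched N)"
    by (rule card_Diff_subset) (auto simp: untouched_def)
  finally show ?thesis
    using card_mono[of E "untouched N"] by (auto simp: untouched_def)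
qed

text \<open>A vertex of \<open>M\<close> adjacent to some \<open>z \<in> N\<close> has
  \<open>z\<close> as its mate, so its matching edge is touched by \<open>N\<close>.\<close>

lemma untouched_disjoint_nbrs:
  assumes "N \<subseteq> M" "e \<in> untouched N"
  shows "e \<inter> set_nbrs G N = {}"
proof -
  have "z \<in> e" if "x \<in> e" "z \<in> N" "x \<in> nbrs G z" for x z
    using that assms E_mate[of e x] nbrs_M[of x] nbrs_sym[of x z]
    by (auto simp: untouched_def E_iff)
  then show ?thesis using assms by (auto simp: untouched_def set_nbrs_def)
qed

lemma m2_in_del_verts:
  assumes N: "N \<subseteq> M"
  shows "m2_in G M (del_verts G (closed_set_nbrs G N)) = card (full_edges N)"
proof -
  let ?H = "del_verts G (closed_set_nbrs G N)"
  have sub: "e \<subseteq> verts ?H \<longleftrightarrow> e \<in> untouched N" if "e \<in> E" for e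
    using that untouched_disjoint_nbrs[OF N, of e] edge_subset[of e] verts_eq
    unfolding verts_del_verts closed_set_nbrs_eq untouched_def E_iff by blast
  have deg: "2 \<le> deg ?H x \<longleftrightarrow> nbrs G x \<inter> W - set_nbrs G N \<noteq> {}"
    if e: "e \<in> untouched N" "x \<in> e" for e x
  proof -
    have "e \<in> E" using e by (simp add: untouched_def)
    then have x: "x \<in> M" using e E_iff by auto
    have ev: "e \<subseteq> verts G - closed_set_nbrs G N"
      using sub \<open>e \<in> E\<close> e by (simp add: verts_del_verts)
    have mate: "mate x \<notin> closed_set_nbrs G N" 
      using ev E_mate[OF \<open>e \<in> E\<close> \<open>x \<in> e\<close>] by auto
    have "nbrs ?H x = nbrs G x - closed_set_nbrs G N"
      using ev e by (intro nbrs_del_verts) auto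
    \<comment> \<open>The mate lies in the same untouched edge and survives; since \<open>W\<close>
      is disjoint from \<open>N\<close>, the neighbours in \<open>W\<close> that disappear are
      exactly those in N(N). The degree in G' is thus one more than the number of remaining
      neighbours in \<open>W\<close>.\<close>
    also have "\<dots> = insert (mate x) (nbrs G x \<inter> W - set_nbrs G N)"
      using mate nbrs_M[OF x] nbrs_subset[of x] verts_eq N W_M_disjoint
      unfolding closed_set_nbrs_eq by blast
    finally have "deg ?H x = Suc (card (nbrs G x \<inter> W - set_nbrs G N))"
      using mate_in_M[OF x] W_M_disjoint unfolding deg_def
      by (metis Diff_iff IntE IntI card_insert_disjoint empty_iff finite_Diff finite_Int finite_W)
    then show ?thesis
      by (simp add: Suc_le_eq card_gt_0_iff numeral_2_eq_2)
  qed
  have "{e \<in> E. e \<subseteq> verts ?H \<and> (\<forall>x\<in>e. deg ?H x \<ge> 2)} = full_edges N"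
    using sub deg by (auto simp: full_edges_def untouched_def)
  then show ?thesis by (simp add: m2_in_def)
qed

lemma m2_in_G: "m2_in G M G = card (full_edges {})"
  using m2_in_del_verts[of "{}"] by (simp add: closed_set_nbrs_eq set_nbrs_def del_verts_empty)

lemma flat1_iff:
  assumes "N \<subseteq> M"
  shows "flat1 G M N \<longleftrightarrow>
    card (full_edges N) + card (set_nbrs G N \<inter> W) = card (full_edges {})"
  using card_set_nbrs[OF assms] unfolding flat1_def m2_in_G m2_in_del_verts[OF assms] by auto

section \<open>Sizes of maximal independent sets in terms of their traces on
  \<open>M\<close>\<close>

lemma filling_exists:
  assumes N: "partial_transversal N"
  obtains P where "partial_transversal (N \<union> P)" "P \<subseteq> \<Union> (untouched N)"
    "\<And>x. x \<in> P \<Longrightarrow> nbrs G x \<inter> W \<subseteq> set_nbrs G N"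
    "untouched (N \<union> P) = full_edges N"
    "card P + card (full_edges N) = card (untouched N)"
proof -
  let ?F = "untouched N - full_edges N"
  have "\<forall>e\<in>?F. \<exists>x\<in>e. nbrs G x \<inter> W \<subseteq> set_nbrs G N"
    by (auto simp: full_edges_def)
  then obtain f where f: "\<And>e. e \<in> ?F \<Longrightarrow> f e \<in> e"
    "\<And>e. e \<in> ?F \<Longrightarrow> nbrs G (f e) \<inter> W \<subseteq> set_nbrs G N"
    by metis
  have f_edge: "e = {f e, mate (f e)}" "f e \<in> M" "f e \<notin> N" "mate (f e) \<notin> N" if "e \<in> ?F" for e
  proof -
    show "e = {f e, mate (f e)}" using that f E_mate by (auto simp: untouched_def)
    then show "f e \<in> M" "f e \<notin> N" "mate (f e) \<notin> N"
      using that f(1)[OF that] by (auto simp: untouched_def E_iff)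
  qed
  have NM: "N \<subseteq> M" using N by (simp add: partial_transversal_def)
  have inj: "inj_on f ?F" by (metis (no_types, lifting) f_edge(1) inj_onI)
  have pt: "partial_transversal (N \<union> f ` ?F)"
    unfolding partial_transversal_def
  proof (intro conjI ballI)
    show "N \<union> f ` ?F \<subseteq> M" using NM f_edge by auto
    fix x assume "x \<in> N \<union> f ` ?F"
    then show "mate x \<notin> N \<union> f ` ?F"
    proof
      assume x: "x \<in> N"
      have "mate x \<noteq> f e" if "e \<in> ?F" for e
        using f_edge(4)[OF that] x mate_mate NM by (metis subsetD)
      then show ?thesis using N x by (auto simp: partial_transversal_def)
    next
      assume "x \<in> f ` ?F"
      then obtain e where e: "e \<in> ?F" "x = f e" by blast
      have "mate x \<noteq> f e'" if e': "e' \<in> ?F" for e'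
      proof
        assume "mate x = f e'"
        then have "e' = e"
          using f_edge[OF e(1)] f_edge(1)[OF e'] e(2) mate_mate by (metis insert_commute)
        then show False using \<open>mate x = f e'\<close> e f_edge(2) mate_neq by metis
      qed
      then show ?thesis using e f_edge(4) by auto
    qed
  qed
  have unt: "untouched (N \<union> f ` ?F) = full_edges N"
  proof (intro equalityI subsetI)
    fix e assume e: "e \<in> untouched (N \<union> f ` ?F)"
    then have "e \<in> untouched N" by (auto simp: untouched_def)
    moreover have "e \<notin> ?F" using e f(1)[of e] by (auto simp: untouched_def)
    ultimately show "e \<in> full_edges N" by auto
  next
    fix e assume e: "e \<in> full_edges N"
    have "f e' \<notin> e" if "e' \<in> ?F" for e'
      using that e f_edge(1)[OF that] E_mate[of e "f e'"] by (auto simp: full_edges_def untouched_def)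
    then show "e \<in> untouched (N \<union> f ` ?F)"
      using e by (auto simp: full_edges_def untouched_def)
  qed
  have "card (f ` ?F) = card (untouched N) - card (full_edges N)"
    using inj full_edges_subset by (simp add: card_image card_Diff_subset)
  moreover have "card (full_edges N) \<le> card (untouched N)"
    using full_edges_subset by (intro card_mono) auto
  ultimately show thesis
    using that[of "f ` ?F"] pt unt f by auto
qed

text \<open>After filling, \<open>N \<union> P\<close> has one vertex in each matching edge that is
  not full for \<open>N\<close>, and joining \<open>W - set_nbrs G N\<close> keeps the set
  independent. The size formula adds the two parts.\<close>

lemma maximal_independent_extending:
  assumes N: "partial_transversal N"
  obtains S where "maximal_independent G S"
    "card S + card (full_edges N) + card (set_nbrs G N \<inter> W) = card E + card W"
proof -
  obtain P where P: "partial_transversal (N \<union> P)" "P \<subseteq> \<Union> (untouched N)"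
    "\<And>x. x \<in> P \<Longrightarrow> nbrs G x \<inter> W \<subseteq> set_nbrs G N"
    "untouched (N \<union> P) = full_edges N"
    "card P + card (full_edges N) = card (untouched N)"
    using filling_exists[OF N] by metis
  let ?U = "W - set_nbrs G N"
  let ?S = "(N \<union> P) \<union> ?U"
  have NP: "N \<union> P \<subseteq> M" using P(1) by (simp add: partial_transversal_def)
  have U: "?U \<inter> set_nbrs G (N \<union> P) = {}" using P(3) by (auto simp: set_nbrs_def)
  have ind: "independent G ?S" by (rule independent_Un[OF P(1) _ U]) auto
  \<comment> \<open>Domination has three sources: an omitted vertex of \<open>W\<close> has a
    neighbour in \<open>N\<close>; a vertex of \<open>M\<close> may have its mate in
    \<open>N \<union> P\<close>; otherwise its edge is full, and the vertex has a neighbour in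
    \<open>W - set_nbrs G N\<close>.\<close>
  have "nbrs G x \<inter> ?S \<noteq> {}" if x: "x \<in> verts G - ?S" for x
  proof (cases "x \<in> W")
    case True
    then show ?thesis using x nbrs_sym by (auto simp: set_nbrs_def)
  next
    case False
    then have xM: "x \<in> M" using x verts_eq by auto
    show ?thesis
    proof (cases "mate x \<in> N \<union> P")
      case True
      then show ?thesis using mate_nbr[OF xM] by auto
    next
      case False
      then have "{x, mate x} \<in> full_edges N"
        using x mate_edge[OF xM] unfolding P(4)[symmetric] untouched_def by auto
      then show ?thesis by (auto simp: full_edges_def)
    qed
  qed
  then have "maximal_independent G ?S" using ind by (auto simp: maximal_independent_def)
  moreover have "card ?S + card (full_edges N) + card (set_nbrs G N \<inter> W) = card E + card W"
  proof -
    have fin: "finite (N \<union> P)" using NP finite_M finite_subset by blast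
    have "card ?S = card (N \<union> P) + card ?U"
      using NP W_M_disjoint by (intro card_Un_disjoint fin) auto
    moreover have "card (N \<union> P) + card (full_edges N) = card E"
      using card_untouched[OF P(1)] P(4) by simp
    moreover have "card ?U + card (set_nbrs G N \<inter> W) = card W"
      using card_Int_Diff[OF finite_W, of "set_nbrs G N"] by (simp add: Int_commute)
    ultimately show ?thesis by simp
  qed
  ultimately show thesis using that by blast
qed

text \<open>Maximality determines \<open>S\<close> from its trace: \<open>S \<inter> W\<close> must
  be all of \<open>W\<close> outside the neighbours of \<open>S \<inter> M\<close>. An edge
  untouched by the trace must be full, because each endpoint can only be dominated from
  \<open>S \<inter> W\<close>. So no filling is left to do and the same size formula holds.\<close>

lemma maximal_independent_trace:
  assumes S: "maximal_independent G S"
  shows "partial_transversal (S \<inter> M)"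
    and "card S + card (full_edges (S \<inter> M)) + card (set_nbrs G (S \<inter> M) \<inter> W) = card E + card W"
proof -
  let ?N = "S \<inter> M"
  have ind: "S \<subseteq> verts G" "S \<inter> set_nbrs G S = {}"
    using S by (auto simp: maximal_independent_def independent_iff)
  show N: "partial_transversal ?N"
    unfolding partial_transversal_def using ind(2) mate_nbr by (auto simp: set_nbrs_def)
  have SW: "S \<inter> W = W - set_nbrs G ?N"
  proof (intro equalityI subsetI)
    fix w assume "w \<in> W - set_nbrs G ?N"
    then have w: "w \<in> W" "nbrs G w \<inter> S = {}"
      using nbrs_W[of w] nbrs_sym by (auto simp: set_nbrs_def)
    then have "w \<in> S" using S verts_eq by (auto simp: maximal_independent_def)
    then show "w \<in> S \<inter> W" using w by simp
  qed (use ind in \<open>auto simp: set_nbrs_def\<close>)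
  have "untouched ?N \<subseteq> full_edges ?N"
  proof
    fix e assume e: "e \<in> untouched ?N"
    have "nbrs G x \<inter> W - set_nbrs G ?N \<noteq> {}" if "x \<in> e" for x
    proof -
      have eE: "e \<in> E" and xM: "x \<in> M" using e that by (auto simp: untouched_def E_iff)
      have "x \<notin> S" "mate x \<notin> S"
        using e that xM E_mate[OF eE that] mate_in_M by (auto simp: untouched_def)
      then obtain y where y: "y \<in> nbrs G x" "y \<in> S"
        using S xM verts_eq by (auto simp: maximal_independent_def)
      then have "y \<in> W"
        using \<open>mate x \<notin> S\<close> nbrs_M[OF xM] subsetD[OF nbrs_subset y(1)] verts_eq
        by (metis IntI UnE singletonD)
      then show ?thesis using y SW by blast
    qed
    then show "e \<in> full_edges ?N" using e by (simp add: full_edges_def)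
  qed
  then have "untouched ?N = full_edges ?N" using full_edges_subset by blast
  then have "card (full_edges ?N) + card ?N = card E" using card_untouched[OF N] by simp
  moreover have "card S = card ?N + card (S \<inter> W)"
  proof -
    have "S = ?N \<union> (S \<inter> W)" using ind verts_eq by auto
    moreover have "?N \<inter> (S \<inter> W) = {}" using W_M_disjoint by auto
    ultimately show ?thesis by (metis card_Un_disjoint finite_Int finite_M finite_W)
  qed
  moreover have "card (S \<inter> W) + card (set_nbrs G ?N \<inter> W) = card W"
    using card_Int_Diff[OF finite_W, of "set_nbrs G ?N"] SW by (simp add: Int_commute)
  ultimately show "card S + card (full_edges ?N) + card (set_nbrs G ?N \<inter> W) = card E + card W"
    by simp
qed

section \<open>From unmixedness to the two parts of (flat)\<close>

lemma flat1_if_unmixed: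
  assumes "unmixed G" "partial_transversal N"
  shows "card (full_edges N) + card (set_nbrs G N \<inter> W) = card (full_edges {})"
proof -
  obtain S where S: "maximal_independent G S"
    "card S + card (full_edges N) + card (set_nbrs G N \<inter> W) = card E + card W"
    using maximal_independent_extending[OF assms(2)] .
  \<comment> \<open>The empty transversal is the reference: it yields a maximal independent set of
    size m + #W - \<open>m\<^sub>2\<close>, with which the one built from \<open>N\<close> is
    compared.\<close>
  have "partial_transversal {}" by (simp add: partial_transversal_def)
  then obtain T where T: "maximal_independent G T"
    "card T + card (full_edges {}) + card (set_nbrs G {} \<inter> W) = card E + card W"
    using maximal_independent_extending by metis
  have "card S = card T" using assms(1) S T unmixed_iff by blast
  then show ?thesis using S T by (simp add: set_nbrs_def)
qed

lemma IN_iff: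
  assumes "N \<subseteq> M"
  shows "x \<in> IN G N W \<longleftrightarrow> x \<in> W0 G W \<and> x \<notin> set_nbrs G N \<and> nbrs G x \<subseteq> closed_set_nbrs G N"
proof (cases "x \<in> verts G - closed_set_nbrs G N")
  case True
  then show ?thesis
    by (auto simp: IN_def isolated_def verts_del_verts nbrs_del_verts closed_set_nbrs_eq)
next
  case False
  moreover have "x \<in> W0 G W \<Longrightarrow> x \<in> verts G \<and> x \<notin> N"
    using assms verts_eq W_M_disjoint by (auto simp: W0_def)
  ultimately show ?thesis
    by (auto simp: IN_def isolated_def verts_del_verts closed_set_nbrs_eq)
qed

text \<open>\<open>?U\<close> consists of the vertices of \<open>W0 G W\<close> that survive in G'
  and are not isolated there. Berge's inequality for \<open>P \<union> ?U\<close> in G' bounds #P +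
  #U by the number of vertices of \<open>M\<close> outside \<open>N\<close>, its mates and
  \<open>P\<close>, that is by 2m - 2 #N - #P. As #N + #P + #\<open>full_edges N\<close> = m, this
  leaves #U at most 2 #\<open>full_edges N\<close>.\<close>

lemma W0_bound_if_unmixed:
  assumes um: "unmixed G" and N: "partial_transversal N"
  shows "card (W0 G W) \<le>
    card (set_nbrs G N \<inter> W) + card (IN G N W) + 2 * card (full_edges N)"
proof -
  obtain P where P: "partial_transversal (N \<union> P)" "P \<subseteq> \<Union> (untouched N)"
    "\<And>x. x \<in> P \<Longrightarrow> nbrs G x \<inter> W \<subseteq> set_nbrs G N"
    "untouched (N \<union> P) = full_edges N"
    "card P + card (full_edges N) = card (untouched N)"
    using filling_exists[OF N] by metis
  have NM: "N \<subseteq> M" and PM: "P \<subseteq> M" using P(1) by (auto simp: partial_transversal_def)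
  have fin: "finite N" "finite P" using NM PM finite_M finite_subset by blast+
  let ?U = "W0 G W - set_nbrs G N - IN G N W"
  let ?A = "P \<union> ?U"
  have UW: "?U \<subseteq> W" by (auto simp: W0_def)
  have finU: "finite ?U" using UW finite_W finite_subset by blast
  have indP: "partial_transversal P" using P(1) by (auto simp: partial_transversal_def)
  have "?U \<inter> set_nbrs G P = {}" using P(3) UW by (auto simp: set_nbrs_def)
  then have indA: "independent G ?A" by (rule independent_Un[OF indP UW])
  have indN: "independent G N"
    using independent_Un[OF N, of "{}"] by simp
  have PN: "P \<inter> set_nbrs G N = {}" using P(2) untouched_disjoint_nbrs[OF NM] by blast
  have matePN: "mate x \<notin> set_nbrs G N" if x: "x \<in> P" for x
  proof -
    obtain e where e: "e \<in> untouched N" "x \<in> e" using x P(2) by blast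
    then have "mate x \<in> e" using E_mate[of e x] by (auto simp: untouched_def)
    then show ?thesis using untouched_disjoint_nbrs[OF NM e(1)] by blast
  qed
  have noniso: "\<exists>u\<in>nbrs G a. u \<notin> set_nbrs G N" if a: "a \<in> ?A" for a
    using a
  proof
    assume "a \<in> P"
    then show ?thesis using matePN mate_nbr PM by blast
  next
    assume "a \<in> ?U"
    then show ?thesis using IN_iff[OF NM, of a] unfolding closed_set_nbrs_eq by blast
  qed
  have "card ?A \<le> card (set_nbrs G ?A - set_nbrs G N)"
    by (rule unmixed_card_le_card_nbrs[OF um indN indA]) (use PN noniso in auto)
  also have "\<dots> \<le> card (M - (N \<union> mate ` N) - P)"
  proof (rule card_mono)
    show "set_nbrs G ?A - set_nbrs G N \<subseteq> M - (N \<union> mate ` N) - P"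
    proof
      fix y assume y: "y \<in> set_nbrs G ?A - set_nbrs G N"
      then obtain a where a: "a \<in> ?A" "y \<in> nbrs G a" by (auto simp: set_nbrs_def)
      \<comment> \<open>Neighbours of \<open>?U\<close> lie in \<open>M\<close> since
        \<open>W\<close> is independent; neighbours of \<open>P\<close> in \<open>W\<close> all lie
        in N(N), which has been removed.\<close>
      have "y \<in> M"
        using a P(3)[of a] nbrs_W UW y nbrs_subset verts_eq by blast
      moreover have "y \<notin> N"
      proof
        assume "y \<in> N"
        then have "a \<in> set_nbrs G N" using a nbrs_sym by (auto simp: set_nbrs_def)
        then show False using a PN by auto
      qed
      moreover have "y \<notin> mate ` N" using y set_nbrs_M[OF NM] by auto
      moreover have "y \<notin> P" using indA y by (auto simp: independent_iff)
      ultimately show "y \<in> M - (N \<union> mate ` N) - P" by blast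
    qed
  qed auto
  also have "\<dots> = card M - 2 * card N - card P"
  proof -
    have mN: "mate ` N \<subseteq> M" "mate ` N \<inter> N = {}" "card (mate ` N) = card N"
      using NM mate_in_M N inj_on_mate
      by (auto simp: partial_transversal_def intro: card_image inj_on_subset)
    have "P \<inter> N = {}" using P(2) by (auto simp: untouched_def)
    moreover have "P \<inter> mate ` N = {}" using PN set_nbrs_M[OF NM] by auto
    ultimately have "card (M - (N \<union> mate ` N) - P) = card (M - (N \<union> mate ` N)) - card P"
      using PM fin by (intro card_Diff_subset) auto
    also have "card (M - (N \<union> mate ` N)) = card M - card (N \<union> mate ` N)"
      using NM mN fin by (intro card_Diff_subset) auto
    also have "card (N \<union> mate ` N) = card N + card N"
      using card_Un_disjoint[of N "mate ` N"] fin mN by (simp add: Int_commute)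
    finally show ?thesis by simp
  qed
  finally have "card ?A \<le> card M - 2 * card N - card P" .
  moreover have "card ?A = card P + card ?U"
    using fin finU PM UW W_M_disjoint by (intro card_Un_disjoint) auto
  ultimately have "card ?U \<le> 2 * card (full_edges N)"
    using card_untouched[OF N] P(5) card_M by linarith
  moreover have "card (W0 G W) \<le> card (?U \<union> (set_nbrs G N \<inter> W) \<union> IN G N W)"
    using finU by (intro card_mono) (auto simp: W0_def IN_def)
  moreover have "card (?U \<union> (set_nbrs G N \<inter> W) \<union> IN G N W) \<le>
      card ?U + card (set_nbrs G N \<inter> W) + card (IN G N W)"
    by (meson add_le_mono1 card_Un_le le_trans)
  ultimately show ?thesis by linarith
qed

section \<open>Equivalence of unmixedness and (flat) for a fixed decomposition\<close>

lemma deg_ge_2_iff: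
  assumes "x \<in> M"
  shows "2 \<le> deg G x \<longleftrightarrow> nbrs G x \<inter> W \<noteq> {}"
proof -
  have "nbrs G x = insert (mate x) (nbrs G x \<inter> W)"
    using nbrs_M[OF assms] nbrs_subset[of x] verts_eq by blast
  moreover have "mate x \<notin> nbrs G x \<inter> W" using mate_in_M[OF assms] W_M_disjoint by blast
  ultimately have "deg G x = Suc (card (nbrs G x \<inter> W))"
    unfolding deg_def by (metis card_insert_disjoint finite_Int finite_nbrs)
  then show ?thesis by (simp add: Suc_le_eq card_gt_0_iff numeral_2_eq_2)
qed

text \<open>Forward, substituting (flat 1) into the bound on \<open>W0 G W\<close> gives (flat 2).
  Backward, (flat 1) applied to the trace of a maximal independent set makes its size the constant m
  + #W - \<open>m\<^sub>2\<close>; the trace must first be reduced to its vertices of degree at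
  least 2, where (flat) applies.\<close>

lemma unmixed_iff_flat: "unmixed G \<longleftrightarrow> flat G W M"
proof
  assume um: "unmixed G"
  have "flat1 G M N \<and> flat2 G W M N" if "partial_transversal N" for N
  proof -
    have NM: "N \<subseteq> M" using that by (simp add: partial_transversal_def)
    have eq: "card (full_edges N) + card (set_nbrs G N \<inter> W) = card (full_edges {})"
      by (rule flat1_if_unmixed[OF um that])
    then show ?thesis
      using W0_bound_if_unmixed[OF um that] flat1_iff[OF NM] card_set_nbrs[OF NM]
      by (simp add: flat2_def m2_in_G)
  qed
  then show "flat G W M" by (auto simp: flat_def partial_transversal_iff)
next
  assume flat: "flat G W M"
  have "card S + card (full_edges {}) = card E + card W" if S: "maximal_independent G S" for S
  proof -
    let ?N = "S \<inter> M"
    let ?N2 = "{x \<in> ?N. 2 \<le> deg G x}"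
    note tr = maximal_independent_trace[OF S]
    have "partial_transversal ?N2" using tr(1) by (auto simp: partial_transversal_def)
    then have "flat1 G M ?N2" using flat by (auto simp: flat_def partial_transversal_iff)
    then have eq: "card (full_edges ?N2) + card (set_nbrs G ?N2 \<inter> W) = card (full_edges {})"
      by (subst (asm) flat1_iff) auto
    text \<open>Vertices of degree one have no neighbour in \<open>W\<close>, so they can be dropped from \<open>?N\<close>.\<close>
    have W: "set_nbrs G ?N2 \<inter> W = set_nbrs G ?N \<inter> W"
      using deg_ge_2_iff by (auto simp: set_nbrs_def)
    then have W': "nbrs G x \<inter> W - set_nbrs G ?N2 = nbrs G x \<inter> W - set_nbrs G ?N" for x by blast
    have "full_edges ?N2 = full_edges ?N"
    proof (intro equalityI subsetI)
      fix e assume e: "e \<in> full_edges ?N2"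
      \<comment> \<open>An endpoint of a full edge has a neighbour in \<open>W\<close>, hence degree
        at least 2; if it were in \<open>?N\<close> it would already be in \<open>?N2\<close> and
        touch the edge.\<close>
      have "x \<notin> ?N" if "x \<in> e" for x
        using e that deg_ge_2_iff[of x] by (auto simp: full_edges_def untouched_def)
      then show "e \<in> full_edges ?N"
        using e unfolding full_edges_def untouched_def W' by blast
    next
      fix e assume "e \<in> full_edges ?N"
      then show "e \<in> full_edges ?N2" using W' by (auto simp: full_edges_def untouched_def)
    qed
    then show ?thesis using tr(2) eq W by simp
  qed
  then show "unmixed G" unfolding unmixed_iff by (metis add_right_cancel)
qed

end

section \<open>From a dominating induced matching to an admissible decomposition, and the
  theorem\<close>

lemma (in simple_graph) admissible_decomposition_exists:
  assumes "dominating_induced_matching G S"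
  shows "admissible_decomposition G (verts G - \<Union> S) (\<Union> S)"
proof -
  have SE: "S \<subseteq> edges G" and disj: "disjoint S" and td: "pairwise (three_disjoint G) S"
    and max: "\<And>e. e \<in> edges G - S \<Longrightarrow> \<not> matching G (insert e S)"
    using assms by (auto simp: dominating_induced_matching_def induced_matching_def
        maximal_matching_def matching_def)
  have "edges (induced G (\<Union> S)) = S"
  proof (intro equalityI subsetI)
    fix e assume "e \<in> edges (induced G (\<Union> S))"
    then have e: "e \<in> edges G" "e \<subseteq> \<Union> S" by (auto simp: induced_def)
    obtain x y where xy: "e = {x, y}" using edge_obtain[OF e(1)] by metis
    then obtain f g where fg: "f \<in> S" "g \<in> S" "x \<in> f" "y \<in> g" using e by auto
    \<comment> \<open>An edge meeting two different members of \<open>S\<close> would contradict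
      their 3-disjointness, so an edge inside \<open>\<Union> S\<close> lies in a single member and
      equals it.\<close>
    have "f = g"
    proof (rule ccontr)
      assume "f \<noteq> g"
      then have "three_disjoint G f g" using td fg by (auto simp: pairwise_def)
      then show False using e(1) xy fg by (auto simp: three_disjoint_def)
    qed
    then have "e \<subseteq> f" using xy fg by auto
    moreover have "card e = card f" "card f = 2" using e(1) fg SE card_edge by auto
    ultimately have "e = f" by (metis card.infinite card_subset_eq zero_neq_numeral)
    then show "e \<in> S" using fg by simp
  qed (use SE in \<open>auto simp: induced_def\<close>)
  moreover have "independent G (verts G - \<Union> S)"
    unfolding independent_def
  proof (intro conjI ballI notI)
    fix x y assume xy: "x \<in> verts G - \<Union> S" "y \<in> verts G - \<Union> S" "{x, y} \<in> edges G"
    then have "{x, y} \<notin> S" by auto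
    \<comment> \<open>An edge avoiding all vertices of \<open>S\<close> could be added to the
      matching, against its maximality.\<close>
    moreover have "matching G (insert {x, y} S)"
      using xy SE disj by (auto simp: matching_def disjoint_def)
    ultimately show False using max xy by auto
  qed auto
  moreover have "\<Union> S \<subseteq> verts G" using SE edge_subset by auto
  ultimately show ?thesis using disj by (auto simp: admissible_decomposition_def)
qed

theorem theorem2p4:
  fixes G :: "'a sgraph"
  assumes "finite_simple_graph G"
    and "\<exists>S. dominating_induced_matching G S"
  shows "(unmixed G \<longleftrightarrow> (\<exists>W M. admissible_decomposition G W M \<and> flat G W M)) \<and>
         (unmixed G \<longleftrightarrow> (\<forall>W M. admissible_decomposition G W M \<longrightarrow> flat G W M))"
proof -
  interpret simple_graph G by unfold_locales (rule assms(1))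
  have iff: "unmixed G \<longleftrightarrow> flat G W M" if "admissible_decomposition G W M" for W M
  proof -
    interpret decomposed_graph G W M by unfold_locales (rule that)
    show ?thesis by (rule unmixed_iff_flat)
  qed
  \<comment> \<open>Without any decomposition, (b) would be false and (c) vacuously true; existence
    makes both equivalent to (flat) for this one decomposition.\<close>
  obtain W M where "admissible_decomposition G W M"
    using assms(2) admissible_decomposition_exists by blast
  then show ?thesis using iff by blast
qed

end
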